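(* Let $A \in \mathbb{Z}^{r \times n}$ be an integer matrix of rank $r$ with no column of zeros. Then $A$ is decomposable if and only if the symmetric matrix $\operatorname{HNF}(A)^\top \operatorname{HNF}(A) \in \mathbb{Z}^{n \times n}$ is reducible.
   Context: The symbol $\top$ denotes transpose. A unimodular matrix is a square integer matrix with determinant $\pm 1$. The direct sum $A_1 \oplus \cdots \oplus A_t$ of matrices is the block-diagonal matrix with diagonal blocks $A_1,\ldots,A_t$ (not necessarily square) and zeros elsewhere. A matrix "decomposes into a direct sum of matrices" if it equals $A_1 \oplus \cdots \oplus A_t$ for some $t \geq 2$ and matrices $A_i$ each having at least one row and at least one column. Decomposable: a matrix $A \in \mathbb{Z}^{m \times n}$ is decomposable if there exist a unimodular matrix $P$ (of size $m \times m$) and a permutation matrix $Q$ (of size $n \times n$) such that $P^{-1} A Q$ decomposes into a direct sum of matrices. Hermite normal form: for $A \in \mathbb{Z}^{m \times n}$ of rank $r$, $\operatorname{HNF}(A)$ is the unique matrix $H = (h_{ij}) \in \mathbb{Z}^{m \times n}$ such that $A = PH$ for some unimodular matrix $P$ and: (a) there is a sequence of integers $1 \leq j_1 < \cdots < j_r \leq n$ such that for each $1 \leq i \leq r$ we have $h_{ij} = 0$ for all $j < j_i$, and the pivot $h_{i\,j_i}$ is positive; (b) for $1 \leq k < i \leq r$ we have $0 \leq h_{k\,j_i} < h_{i\,j_i}$; (c) the last $m-r$ rows of $H$ are zero. Reducible: a symmetric matrix $B \in \mathbb{Z}^{n \times n}$ is reducible if there exists a permutation matrix $Q$ such that $Q^\top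 B Q$ decomposes into a direct sum of square matrices (that is, it equals $B_1 \oplus \cdots \oplus B_t$ with $t \geq 2$ and each $B_i$ square of size at least $1$). *)

theory Defs
  imports "Jordan_Normal_Form.DL_Rank"
begin

definition unimodular_mat :: "int mat \<Rightarrow> bool" where
  "unimodular_mat P \<longleftrightarrow> square_mat P \<and> det P \<in> {1, -1}"

definition permutation_mat :: "int mat \<Rightarrow> bool" where
  "permutation_mat Q \<longleftrightarrow>
     (\<exists>p. p permutes {..<dim_row Q} \<and>
          Q = mat (dim_row Q) (dim_row Q) (\<lambda>(i, j). if i = p j then 1 else 0))"

definition nonempty_mat :: "int mat \<Rightarrow> bool" where
  "nonempty_mat M \<longleftrightarrow> dim_row M \<ge> 1 \<and> dim_col M \<ge> 1"

definition decomposes_direct_sum :: "int mat \<Rightarrow> bool" where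
  "decomposes_direct_sum M \<longleftrightarrow>
     (\<exists>Bs. length Bs \<ge> 2 \<and> (\<forall>B \<in> set Bs. nonempty_mat B) \<and> M = diag_block_mat Bs)"

definition decomposes_direct_sum_square :: "int mat \<Rightarrow> bool" where
  "decomposes_direct_sum_square M \<longleftrightarrow>
     (\<exists>Bs. length Bs \<ge> 2 \<and> (\<forall>B \<in> set Bs. nonempty_mat B \<and> square_mat B) \<and>
           M = diag_block_mat Bs)"

text \<open>The library has no inverse operation for integer matrices, so \<open>R\<close> below names the
  inverse of \<open>P\<close>.\<close>

definition decomposable :: "int mat \<Rightarrow> bool" where
  "decomposable A \<longleftrightarrow>
     (\<exists>P R Q. P \<in> carrier_mat (dim_row A) (dim_row A) \<and> unimodular_mat P \<and>
              R \<in> carrier_mat (dim_row A) (dim_row A) \<and> inverts_mat P R \<and> inverts_mat R P \<and>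
              Q \<in> carrier_mat (dim_col A) (dim_col A) \<and> permutation_mat Q \<and>
              decomposes_direct_sum (R * A * Q))"

definition reducible :: "int mat \<Rightarrow> bool" where
  "reducible B \<longleftrightarrow>
     square_mat B \<and> B\<^sup>T = B \<and>
     (\<exists>Q. Q \<in> carrier_mat (dim_row B) (dim_row B) \<and> permutation_mat Q \<and>
          decomposes_direct_sum_square (Q\<^sup>T * B * Q))"

definition int_rank :: "int mat \<Rightarrow> nat" where
  "int_rank A = vec_space.rank (dim_row A) (map_mat rat_of_int A)"

text \<open>Rows, columns and pivots are indexed from 0: \<open>c i\<close> is the pivot column of row \<open>i\<close>.\<close>

definition is_hnf_of :: "int mat \<Rightarrow> int mat \<Rightarrow> bool" where
  "is_hnf_of A H \<longleftrightarrow>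
     (let m = dim_row A; n = dim_col A; r = int_rank A in
        H \<in> carrier_mat m n \<and>
        (\<exists>P. P \<in> carrier_mat m m \<and> unimodular_mat P \<and> A = P * H) \<and>
        (\<exists>c :: nat \<Rightarrow> nat.
           strict_mono_on {..<r} c \<and>
           (\<forall>i<r. c i < n \<and> (\<forall>j<c i. H $$ (i, j) = 0) \<and> H $$ (i, c i) > 0) \<and>
           (\<forall>i<r. \<forall>k<i. 0 \<le> H $$ (k, c i) \<and> H $$ (k, c i) < H $$ (i, c i))) \<and>
        (\<forall>i. r \<le> i \<and> i < m \<longrightarrow> (\<forall>j<n. H $$ (i, j) = 0)))"

definition hnf :: "int mat \<Rightarrow> int mat" where
  "hnf A = (THE H. is_hnf_of A H)"

end

theory Submission
  imports Defs
begin

text \<open>Let \<open>H\<close> be the Hermite normal form of \<open>A\<close>. Both sides of the equivalence say that the columns fall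
  into two nonempty classes, \<open>S\<close> and its complement, such that every row of \<open>H\<close> is supported in one of
  them.

  Up to permutations, \<open>A\<close> is decomposable if and only if some matrix row equivalent to \<open>A\<close>
  has its rows split in this way (\<open>decomposable_iff_rows_split\<close>); the block of rows
  belonging to each class is nonempty because \<open>A\<close> has no zero column. Such a splitting is inherited by
  \<open>H\<close> (\<open>rows_split_hermite\<close>). Indeed, it makes the row lattice closed under the projection
  to the coordinates in \<open>S\<close>. For a row of \<open>H\<close> take the projection to the class that does not contain its pivot
  column. This is a lattice vector whose entries in the pivot columns are smaller than the pivots, by
  the reducedness of \<open>H\<close>. But the leading entry of a nonzero lattice vector lies in a pivot column and is a
  multiple of the pivot (\<open>row_lattice_leading_entry\<close>), so the projection is zero.

  On the other side, \<open>H\<^sup>T H\<close> is reducible if and only if the columns of \<open>H\<close> in \<open>S\<close> are orthogonal to those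
  outside, for some nontrivial \<open>S\<close> (\<open>reducible_iff_partition\<close>). If the rows of \<open>H\<close> split, this is clear. For the
  converse one compares pivot columns with columns of the other class, row by row from
  the top: each scalar product reduces to the pivot times one entry, which must be zero
  (\<open>gram_orthogonal_imp_zero\<close>).

  It remains to know that \<open>A\<close> has a unique Hermite normal form with \<open>r\<close> pivots. Existence is proved by
  reducing one column after the other (\<open>hermite_prefix_step\<close>), full rank gives the number of pivots
  (\<open>hermite_prefix_full_row_rank\<close>), and uniqueness follows again from the leading entries of
  lattice vectors (\<open>hermite_form_unique\<close>).\<close>

section \<open>Row equivalence over the integers\<close>

lemma index_mult_mat_sum:
  assumes "A \<in> carrier_mat r m" "B \<in> carrier_mat m n" "i < r" "j < n"
  shows "(A * B) $$ (i, j) = (\<Sum>k<m. A $$ (i, k) * B $$ (k, j))"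
  using assms by (auto simp: scalar_prod_def atLeast0LessThan)

definition row_equiv :: "int mat \<Rightarrow> int mat \<Rightarrow> bool" where
  "row_equiv A H \<longleftrightarrow>
     H \<in> carrier_mat (dim_row A) (dim_col A) \<and>
     (\<exists>P R. P \<in> carrier_mat (dim_row A) (dim_row A) \<and> R \<in> carrier_mat (dim_row A) (dim_row A) \<and>
            P * R = 1\<^sub>m (dim_row A) \<and> R * P = 1\<^sub>m (dim_row A) \<and> A = P * H)"

text \<open>The inverse of an integer matrix of determinant \<open>d\<close> with \<open>d\<^sup>2 = 1\<close> is \<open>d\<close> times its adjugate;
  conversely the two determinants multiply to \<open>1\<close> in \<open>\<int>\<close>. This allows row equivalence to be handled
  through explicit inverses, without any determinant computation.\<close>

lemma unimodular_iff_inverse: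
  assumes P: "P \<in> carrier_mat r r"
  shows "unimodular_mat P \<longleftrightarrow> (\<exists>R \<in> carrier_mat r r. P * R = 1\<^sub>m r \<and> R * P = 1\<^sub>m r)"
proof
  assume "unimodular_mat P"
  hence d: "det P * det P = 1" by (auto simp: unimodular_mat_def)
  have a: "adj_mat P \<in> carrier_mat r r" using adj_mat(1)[OF P] .
  let ?R = "det P \<cdot>\<^sub>m adj_mat P"
  have "P * ?R = 1\<^sub>m r" "?R * P = 1\<^sub>m r"
    using adj_mat[OF P] P a d
    by (auto simp: mult_smult_distrib[OF P a] mult_smult_assoc_mat[OF a P] intro!: eq_matI)
  thus "\<exists>R \<in> carrier_mat r r. P * R = 1\<^sub>m r \<and> R * P = 1\<^sub>m r" using a by auto
next
  assume "\<exists>R \<in> carrier_mat r r. P * R = 1\<^sub>m r \<and> R * P = 1\<^sub>m r"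
  then obtain R where R: "R \<in> carrier_mat r r" "P * R = 1\<^sub>m r" by auto
  have "det P * det R = 1" using det_mult[OF P R(1)] R(2) by simp
  hence "det P = 1 \<or> det P = -1" by (auto simp: zmult_eq_1_iff)
  thus "unimodular_mat P" using P by (auto simp: unimodular_mat_def)
qed

lemma row_equiv_iff_unimodular:
  "row_equiv A H \<longleftrightarrow> H \<in> carrier_mat (dim_row A) (dim_col A) \<and>
     (\<exists>P. P \<in> carrier_mat (dim_row A) (dim_row A) \<and> unimodular_mat P \<and> A = P * H)"
  unfolding row_equiv_def using unimodular_iff_inverse by blast

lemma row_equivE:
  assumes "row_equiv A H" "A \<in> carrier_mat r n"
  obtains P R where "P \<in> carrier_mat r r" "R \<in> carrier_mat r r" "P * R = 1\<^sub>m r" "R * P = 1\<^sub>m r"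
    "A = P * H" "R * A = H" "H \<in> carrier_mat r n"
proof -
  have d: "dim_row A = r" "dim_col A = n" using assms(2) by auto
  obtain P R where *: "P \<in> carrier_mat r r" "R \<in> carrier_mat r r" "P * R = 1\<^sub>m r" "R * P = 1\<^sub>m r"
    "A = P * H" and H: "H \<in> carrier_mat r n" using assms(1) unfolding row_equiv_def d by auto
  have "R * A = (R * P) * H" using * H by (metis assoc_mult_mat)
  hence "R * A = H" using * H by auto
  thus thesis using that * H by auto
qed

lemma row_equivI:
  assumes "A \<in> carrier_mat r n" "P \<in> carrier_mat r r" "R \<in> carrier_mat r r"
    "P * R = 1\<^sub>m r" "R * P = 1\<^sub>m r" "A = P * H" "H \<in> carrier_mat r n"
  shows "row_equiv A H"
  using assms unfolding row_equiv_def by auto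

lemma row_equiv_refl: "row_equiv A A"
  by (rule row_equivI[of _ "dim_row A" "dim_col A" "1\<^sub>m (dim_row A)" "1\<^sub>m (dim_row A)"]) auto

lemma row_equiv_dims:
  assumes "row_equiv A H" shows "dim_row H = dim_row A" "dim_col H = dim_col A"
  using assms unfolding row_equiv_def by auto

lemma row_equiv_mult:
  assumes A: "A \<in> carrier_mat r n" and "row_equiv A H"
    and M: "M \<in> carrier_mat r r" and N: "N \<in> carrier_mat r r"
    and MN: "M * N = 1\<^sub>m r" and NM: "N * M = 1\<^sub>m r"
  shows "row_equiv A (M * H)"
proof -
  obtain P R where P: "P \<in> carrier_mat r r" and R: "R \<in> carrier_mat r r" and PR: "P * R = 1\<^sub>m r"
    and RP: "R * P = 1\<^sub>m r" and AP: "A = P * H" and H: "H \<in> carrier_mat r n"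
    using row_equivE[OF assms(2) A] by metis
  have "(P * N) * (M * R) = P * ((N * M) * R)"
    using P N M R by (simp add: assoc_mult_mat[of _ r r _ r _ r])
  hence 1: "(P * N) * (M * R) = 1\<^sub>m r" using NM R PR by simp
  have "(M * R) * (P * N) = M * ((R * P) * N)"
    using P N M R by (simp add: assoc_mult_mat[of _ r r _ r _ r])
  hence 2: "(M * R) * (P * N) = 1\<^sub>m r" using RP N MN by simp
  have "(P * N) * (M * H) = P * ((N * M) * H)"
    using P N M H by (simp add: assoc_mult_mat[of _ r r _ r _ n])
  hence 3: "A = (P * N) * (M * H)" using NM H AP by simp
  show ?thesis
    by (rule row_equivI[OF A _ _ 1 2 3]) (use P N M R H in auto)
qed

text \<open>Symmetry and transitivity in one: any two matrices row equivalent to \<open>A\<close> are row equivalent to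
  each other.\<close>

lemma row_equiv_euclidean:
  assumes A: "A \<in> carrier_mat r n" and "row_equiv A H" "row_equiv A H'"
  shows "row_equiv H H'"
proof -
  obtain P R where P: "P \<in> carrier_mat r r" and R: "R \<in> carrier_mat r r" and PR: "P * R = 1\<^sub>m r"
    and RP: "R * P = 1\<^sub>m r" and AP: "R * A = H" and H: "H \<in> carrier_mat r n"
    using row_equivE[OF assms(2) A] by metis
  obtain P' R' where P': "P' \<in> carrier_mat r r" and R': "R' \<in> carrier_mat r r" and PR': "P' * R' = 1\<^sub>m r"
    and RP': "R' * P' = 1\<^sub>m r" and AP': "A = P' * H'" and H': "H' \<in> carrier_mat r n"
    using row_equivE[OF assms(3) A] by metis
  have "(R * P') * (R' * P) = R * ((P' * R') * P)"
    using P P' R R' by (simp add: assoc_mult_mat[of _ r r _ r _ r])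
  hence 1: "(R * P') * (R' * P) = 1\<^sub>m r" using PR' P RP by simp
  have "(R' * P) * (R * P') = R' * ((P * R) * P')"
    using P P' R R' by (simp add: assoc_mult_mat[of _ r r _ r _ r])
  hence 2: "(R' * P) * (R * P') = 1\<^sub>m r" using PR P' RP' by simp
  have 3: "H = (R * P') * H'"
    using AP AP' R P' H' by (simp add: assoc_mult_mat[of _ r r _ r _ n])
  show ?thesis
    by (rule row_equivI[OF H _ _ 1 2 3]) (use P P' R R' H' in auto)
qed

text \<open>Adding multiples of row \<open>p\<close> to all other rows at once is left multiplication by a matrix
  \<open>E f\<close>, whose inverse is \<open>E (- f)\<close> because row \<open>p\<close> itself stays fixed. Doing all rows in one
  operation lets a single step clear the entries below a pivot and reduce those above it.\<close>

lemma row_equiv_add_multiples: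
  assumes A: "A \<in> carrier_mat r n" and e: "row_equiv A H" and p: "p < r" and fp: "f p = 0"
  shows "row_equiv A (mat r n (\<lambda>(i, j). H $$ (i, j) + f i * H $$ (p, j)))"
proof -
  define E where "E = (\<lambda>g :: nat \<Rightarrow> int.
    mat r r (\<lambda>(i, k). (if i = k then 1 else 0) + (if k = p then g i else 0)))"
  have E: "E g \<in> carrier_mat r r" for g by (simp add: E_def)
  have EM: "(E g * M) $$ (i, j) = M $$ (i, j) + g i * M $$ (p, j)"
    if "M \<in> carrier_mat r m" "i < r" "j < m" for g M m i j
  proof -
    have "(E g * M) $$ (i, j) = (\<Sum>k<r. E g $$ (i, k) * M $$ (k, j))"
      by (rule index_mult_mat_sum[OF E that])
    also have "\<dots> = (\<Sum>k<r. (if i = k then M $$ (k, j) else 0) + (if k = p then g i * M $$ (k, j) else 0))"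
      by (rule sum.cong) (use that in \<open>auto simp: E_def algebra_simps\<close>)
    finally show ?thesis using that p by (simp add: sum.distrib)
  qed
  have inv: "E g * E (\<lambda>i. - g i) = 1\<^sub>m r" if "g p = 0" for g
  proof (rule eq_matI)
    fix i j assume "i < dim_row (1\<^sub>m r :: int mat)" "j < dim_col (1\<^sub>m r :: int mat)"
    hence ij: "i < r" "j < r" by auto
    show "(E g * E (\<lambda>i. - g i)) $$ (i, j) = 1\<^sub>m r $$ (i, j)"
      unfolding EM[OF E ij] using ij p that by (auto simp: E_def)
  qed (auto simp: E_def)
  have "row_equiv A (E f * H)"
    by (rule row_equiv_mult[OF A e E[of f] E[of "\<lambda>i. - f i"]])
       (use inv[of f] inv[of "\<lambda>i. - f i"] fp in auto)
  moreover have "E f * H = mat r n (\<lambda>(i, j). H $$ (i, j) + f i * H $$ (p, j))"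
    by (rule eq_matI) (use A row_equiv_dims[OF e] E[of f] in \<open>auto simp: EM[of H n] simp del: index_mult_mat(1)\<close>)
  ultimately show ?thesis by simp
qed

lemma row_equiv_swaprows:
  assumes A: "A \<in> carrier_mat r n" and e: "row_equiv A H" and "k < r" "l < r"
  shows "row_equiv A (swaprows k l H)"
proof -
  have H: "H \<in> carrier_mat r n" using A row_equiv_dims[OF e] by auto
  show ?thesis unfolding swaprows_mat[OF H assms(3,4)]
    by (rule row_equiv_mult[OF A e _ _ swaprows_mat_inv[OF assms(3,4)] swaprows_mat_inv[OF assms(3,4)]]) auto
qed

lemma row_equiv_negate_row:
  assumes A: "A \<in> carrier_mat r n" and e: "row_equiv A H" and k: "k < r"
  shows "row_equiv A (multrow k (-1) H)"
proof -
  have H: "H \<in> carrier_mat r n" using A row_equiv_dims[OF e] by auto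
  let ?M = "multrow_mat r k (-1) :: int mat"
  have "?M * ?M = multrow k (-1) ?M" by (rule multrow_mat[symmetric, of _ _ r]) simp
  also have "\<dots> = 1\<^sub>m r" by (rule eq_matI) (use k in auto)
  finally have inv: "?M * ?M = 1\<^sub>m r" .
  show ?thesis unfolding multrow_mat[OF H]
    by (rule row_equiv_mult[OF A e _ _ inv inv]) auto
qed

section \<open>Existence of the Hermite normal form\<close>

text \<open>The state of the column-by-column reduction after \<open>j\<close> columns: the first \<open>k\<close> rows have pivots
  in these columns, and the remaining rows vanish on them. Taking for \<open>j\<close> the number of all columns
  and for \<open>k\<close> the rank gives the Hermite normal form.\<close>

definition hermite_prefix :: "int mat \<Rightarrow> nat \<Rightarrow> nat \<Rightarrow> (nat \<Rightarrow> nat) \<Rightarrow> bool" where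
  "hermite_prefix H j k c \<longleftrightarrow>
     k \<le> dim_row H \<and> strict_mono_on {..<k} c \<and>
     (\<forall>i<k. c i < j \<and> (\<forall>l<c i. H $$ (i, l) = 0) \<and> H $$ (i, c i) > 0) \<and>
     (\<forall>i<k. \<forall>h<i. 0 \<le> H $$ (h, c i) \<and> H $$ (h, c i) < H $$ (i, c i)) \<and>
     (\<forall>i. k \<le> i \<and> i < dim_row H \<longrightarrow> (\<forall>l<j. H $$ (i, l) = 0))"

lemma hermite_prefixD:
  assumes "hermite_prefix H j k c" "i < k"
  shows "c i < j" and "\<And>l. l < c i \<Longrightarrow> H $$ (i, l) = 0" and "H $$ (i, c i) > 0"
    and "\<And>h. h < i \<Longrightarrow> c h < c i"
    and "\<And>h. h < i \<Longrightarrow> 0 \<le> H $$ (h, c i) \<and> H $$ (h, c i) < H $$ (i, c i)"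
  using assms unfolding hermite_prefix_def strict_mono_on_def by auto

lemma hermite_prefix_cong:
  assumes "hermite_prefix H j k c" "dim_row H' = dim_row H"
    and "\<And>i l. i < dim_row H \<Longrightarrow> l < j \<Longrightarrow> H' $$ (i, l) = H $$ (i, l)"
  shows "hermite_prefix H' j k c"
  using assms(1) unfolding hermite_prefix_def assms(2)
  by (auto simp: assms(3))

lemma hermite_prefix_extend:
  assumes pre: "hermite_prefix H j k c" and k: "k < dim_row H"
    and piv: "H $$ (k, j) > 0"
    and below: "\<And>i. k < i \<Longrightarrow> i < dim_row H \<Longrightarrow> H $$ (i, j) = 0"
    and above: "\<And>i. i < k \<Longrightarrow> 0 \<le> H $$ (i, j) \<and> H $$ (i, j) < H $$ (k, j)"
  shows "hermite_prefix H (Suc j) (Suc k) (c(k := j))"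
proof -
  have "c i < j" if "i < k" for i using pre that unfolding hermite_prefix_def by auto
  hence "strict_mono_on {..<Suc k} (c(k := j))"
    using pre unfolding hermite_prefix_def strict_mono_on_def
    by (auto simp: less_Suc_eq)
  thus ?thesis using assms unfolding hermite_prefix_def
    by (auto simp: less_Suc_eq Suc_le_eq)
qed

text \<open>If column \<open>j\<close> has a nonzero entry in some row from \<open>k\<close> on, consider all matrices row equivalent
  to \<open>A\<close> with the same reduced prefix, and choose one with a positive entry \<open>d\<close> in such a row
  \<open>p\<close> that is as small as possible. Subtracting multiples of row \<open>p\<close> replaces every other
  entry of the column by its remainder modulo \<open>d\<close>. In the rows from \<open>k\<close> on these remainders
  are zero, since a nonzero one would be a smaller candidate; in the rows before \<open>k\<close> they are
  the reduced entries that the normal form asks for. Earlier columns are untouched, because row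
  \<open>p\<close> vanishes there. Minimality thus replaces the Euclidean algorithm.\<close>

lemma hermite_prefix_step:
  assumes A: "A \<in> carrier_mat r n" and e: "row_equiv A H" and pre: "hermite_prefix H j k c" and j: "j < n"
  shows "\<exists>H' k' c'. row_equiv A H' \<and> hermite_prefix H' (Suc j) k' c'"
proof (cases "\<forall>i. k \<le> i \<and> i < r \<longrightarrow> H $$ (i, j) = 0")
  case True
  have "hermite_prefix H (Suc j) k c"
    using pre True A row_equiv_dims[OF e] unfolding hermite_prefix_def by (auto simp: less_Suc_eq)
  thus ?thesis using e by blast
next
  case False
  then obtain p0 where p0: "k \<le> p0" "p0 < r" "H $$ (p0, j) \<noteq> 0" by auto
  \<comment> \<open>the candidates: a matrix together with the row of its positive entry\<close>
  define G where "G = (\<lambda>(X, p). row_equiv A X \<and> hermite_prefix X j k c \<and> k \<le> p \<and> p < r \<and> X $$ (p, j) > 0)"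
  have "\<exists>Xp. G Xp"
  proof (cases "H $$ (p0, j) > 0")
    case True
    thus ?thesis using e pre p0 by (intro exI[of _ "(H, p0)"]) (auto simp: G_def)
  next
    case False
    have dH: "dim_row H = r" "dim_col H = n" using A row_equiv_dims[OF e] by auto
    have "H $$ (p0, l) = 0" if "l < j" for l
      using pre that p0 dH unfolding hermite_prefix_def by auto
    hence "hermite_prefix (multrow p0 (-1) H) j k c"
      using j p0 dH by (intro hermite_prefix_cong[OF pre]) auto
    thus ?thesis using row_equiv_negate_row[OF A e p0(2)] p0 False j dH
      by (intro exI[of _ "(multrow p0 (-1) H, p0)"]) (auto simp: G_def)
  qed
  then obtain Xp where "G Xp" and least: "\<And>Yq. G Yq \<Longrightarrow> nat (fst Xp $$ (snd Xp, j)) \<le> nat (fst Yq $$ (snd Yq, j))"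
    using ex_has_least_nat[of G _ "\<lambda>Xp. nat (fst Xp $$ (snd Xp, j))"] by blast
  then obtain X p where G: "G (X, p)"
    and least: "\<And>Y q. G (Y, q) \<Longrightarrow> nat (X $$ (p, j)) \<le> nat (Y $$ (q, j))"
    by (cases Xp) fastforce
  define d where "d = X $$ (p, j)"
  have eX: "row_equiv A X" and preX: "hermite_prefix X j k c" and kp: "k \<le> p" and p: "p < r" and d: "d > 0"
    using G by (auto simp: G_def d_def)
  have dX: "dim_row X = r" "dim_col X = n" using A row_equiv_dims[OF eX] by auto
  \<comment> \<open>these multiples turn each entry of column j outside row p into its remainder modulo d\<close>
  define f where "f = (\<lambda>i. if i = p then 0 else - (X $$ (i, j) div d))"
  define Y where "Y = mat r n (\<lambda>(i, l). X $$ (i, l) + f i * X $$ (p, l))"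
  have eY: "row_equiv A Y" unfolding Y_def by (rule row_equiv_add_multiples[OF A eX p]) (simp add: f_def)
  have dY: "dim_row Y = r" "dim_col Y = n" by (auto simp: Y_def)
  have "X $$ (p, l) = 0" if "l < j" for l
    using preX that kp p dX unfolding hermite_prefix_def by auto
  hence preY: "hermite_prefix Y j k c"
    using j by (intro hermite_prefix_cong[OF preX]) (auto simp: Y_def dX)
  have Yp: "Y $$ (p, j) = d" using p j by (simp add: Y_def f_def d_def)
  have Yi: "Y $$ (i, j) = X $$ (i, j) mod d" if "i < r" "i \<noteq> p" for i
    using that j by (simp add: Y_def f_def d_def[symmetric] minus_div_mult_eq_mod)
  have Y0: "Y $$ (i, j) = 0" if "k \<le> i" "i < r" "i \<noteq> p" for i
  proof (rule ccontr)
    assume "Y $$ (i, j) \<noteq> 0"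
    with Yi[OF that(2,3)] pos_mod_bound[OF d, of "X $$ (i, j)"] pos_mod_sign[OF d, of "X $$ (i, j)"]
    have "0 < Y $$ (i, j)" "Y $$ (i, j) < d" by auto
    moreover from this have "G (Y, i)" using eY preY that by (auto simp: G_def)
    ultimately show False using least[of Y i] by (simp add: d_def)
  qed
  have kr: "k < r" using kp p by simp
  \<comment> \<open>rows k and p both vanish in the columns before j, so exchanging them keeps the prefix\<close>
  let ?Z = "swaprows k p Y"
  have eZ: "row_equiv A ?Z" by (rule row_equiv_swaprows[OF A eY kr p])
  have zero: "Y $$ (i, l) = 0" if "k \<le> i" "i < r" "l < j" for i l
    using preY that dY unfolding hermite_prefix_def by auto
  have "hermite_prefix ?Z j k c"
    by (rule hermite_prefix_cong[OF preY]) (use zero kp p kr j dY in auto)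
  hence "hermite_prefix ?Z (Suc j) (Suc k) (c(k := j))"
  proof (rule hermite_prefix_extend)
    show "?Z $$ (i, j) = 0" if "k < i" "i < dim_row ?Z" for i
      using that Y0[of i] Y0[of k] kr kp p j dY by auto
    show "0 \<le> ?Z $$ (i, j) \<and> ?Z $$ (i, j) < ?Z $$ (k, j)" if "i < k" for i
      using that Yi[of i] Yp kr kp p j dY d by auto
  qed (use dY kr j p Yp d in auto)
  thus ?thesis using eZ by blast
qed

lemma ex_hermite_form:
  assumes A: "A \<in> carrier_mat r n"
  shows "\<exists>H k c. row_equiv A H \<and> hermite_prefix H n k c"
proof -
  have "\<exists>H k c. row_equiv A H \<and> hermite_prefix H j k c" if "j \<le> n" for j
    using that
  proof (induction j)
    case 0
    have "hermite_prefix A 0 0 id" by (auto simp: hermite_prefix_def)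
    thus ?case using row_equiv_refl by blast
  next
    case (Suc j)
    thus ?case using hermite_prefix_step[OF A] by (meson Suc_le_eq Suc_leD)
  qed
  thus ?thesis by blast
qed

section \<open>Full row rank\<close>

text \<open>A maximal independent set of columns has \<open>n\<close> elements, hence is a basis; so the columns span the
  whole space, and a vector orthogonal to all of them is orthogonal to every unit vector.\<close>

lemma (in vec_space) orthogonal_to_full_rank:
  assumes A: "A \<in> carrier_mat n nc" and rk: "rank A = n"
    and u: "u \<in> carrier_vec n" and orth: "\<And>v. v \<in> set (cols A) \<Longrightarrow> u \<bullet> v = 0"
  shows "u = 0\<^sub>v n"
proof -
  have sub: "set (cols A) \<subseteq> carrier_vec n" using A cols_dim by blast
  obtain S where S: "maximal S (\<lambda>T. T \<subseteq> set (cols A) \<and> lin_indpt T)" "finite S"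
    using maximal_exists_superset[of "set (cols A)" "\<lambda>T. T \<subseteq> set (cols A) \<and> lin_indpt T" "{}"]
    by (auto simp: lin_dep_def)
  have SA: "S \<subseteq> set (cols A)" "lin_indpt S" using S unfolding maximal_def by auto
  have "card S = n" using rank_card_indpt[OF A S(1)] rk by simp
  hence "basis S" using SA sub S(2) by (intro dim_li_is_basis) (auto simp: dim_is_n)
  hence span: "span S = carrier_vec n" by (simp add: basis_def)
  define W where "W = {v \<in> carrier_vec n. u \<bullet> v = 0}"
  have "submodule class_ring W V"
    by (rule submodule.intro)
       (use u vec_module in \<open>auto simp: W_def module_vec_simps scalar_prod_add_distrib[of _ n]\<close>)
  moreover have "S \<subseteq> W" using SA sub orth by (auto simp: W_def)
  ultimately have "span S \<subseteq> W" using span_is_subset by blast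
  hence "u \<bullet> unit_vec n i = 0" if "i < n" for i using span by (auto simp: W_def)
  thus ?thesis using u by (intro eq_vecI) (auto simp: scalar_prod_right_unit)
qed

lemma full_row_rank_no_relation:
  fixes A :: "int mat"
  assumes A: "A \<in> carrier_mat r n" and rk: "int_rank A = r"
    and rel: "\<And>j. j < n \<Longrightarrow> (\<Sum>i<r. a i * A $$ (i, j)) = 0" and i: "i < r"
  shows "a i = 0"
proof -
  interpret vec_space "TYPE(rat)" r .
  let ?A = "map_mat rat_of_int A"
  define u where "u = vec r (\<lambda>i. rat_of_int (a i))"
  have "u = 0\<^sub>v r"
  proof (rule orthogonal_to_full_rank)
    show "?A \<in> carrier_mat r n" using A by simp
    show "rank ?A = r" using rk A by (simp add: int_rank_def)
    show "u \<in> carrier_vec r" by (simp add: u_def)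
    fix v assume "v \<in> set (cols ?A)"
    then obtain j where j: "j < n" "v = col ?A j" using A by (auto simp: cols_def)
    have "u \<bullet> v = (\<Sum>i<r. rat_of_int (a i * A $$ (i, j)))"
      using A j by (auto simp: scalar_prod_def u_def atLeast0LessThan)
    also have "\<dots> = 0" using rel[OF j(1)] by (metis of_int_0 of_int_sum)
    finally show "u \<bullet> v = 0" .
  qed
  hence "u $ i = 0" using i by simp
  thus ?thesis using i by (simp add: u_def)
qed

text \<open>If there were fewer than \<open>r\<close> pivots, row \<open>k\<close> of \<open>H = R A\<close> would be zero. Row \<open>k\<close> of \<open>R\<close>
  would then be a relation between the rows of \<open>A\<close>, hence zero, although \<open>R\<close> is invertible.\<close>

lemma hermite_prefix_full_row_rank:
  assumes A: "A \<in> carrier_mat r n" and rk: "int_rank A = r"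
    and e: "row_equiv A H" and pre: "hermite_prefix H n k c"
  shows "k = r"
proof (rule ccontr)
  assume "k \<noteq> r"
  moreover have dH: "dim_row H = r" "dim_col H = n" using A row_equiv_dims[OF e] by auto
  ultimately have k: "k < r" using pre by (auto simp: hermite_prefix_def)
  obtain P R where P: "P \<in> carrier_mat r r" and R: "R \<in> carrier_mat r r" and RP: "R * P = 1\<^sub>m r"
    and RA: "R * A = H"
    using row_equivE[OF e A] by metis
  have "R $$ (k, i) = 0" if "i < r" for i
  proof (rule full_row_rank_no_relation[OF A rk _ that])
    fix j assume j: "j < n"
    have "(\<Sum>i<r. R $$ (k, i) * A $$ (i, j)) = H $$ (k, j)"
      using index_mult_mat_sum[OF R A k j] RA by simp
    also have "\<dots> = 0" using pre k j dH by (auto simp: hermite_prefix_def)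
    finally show "(\<Sum>i<r. R $$ (k, i) * A $$ (i, j)) = 0" .
  qed
  hence "(R * P) $$ (k, k) = 0" using index_mult_mat_sum[OF R P k k] by simp
  thus False using RP k by simp
qed

section \<open>The row lattice and uniqueness of the Hermite normal form\<close>

text \<open>Vectors are functions here, of which only the values below the number of columns matter.\<close>

definition in_row_lattice :: "int mat \<Rightarrow> (nat \<Rightarrow> int) \<Rightarrow> bool" where
  "in_row_lattice H w \<longleftrightarrow> (\<exists>a. \<forall>j<dim_col H. w j = (\<Sum>l<dim_row H. a l * H $$ (l, j)))"

lemma in_row_lattice_row:
  assumes "i < dim_row H" shows "in_row_lattice H (\<lambda>j. H $$ (i, j))"
  unfolding in_row_lattice_def
proof (intro exI[of _ "\<lambda>l. if l = i then 1 else 0"] allI impI)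
  fix j
  have "(\<Sum>l<dim_row H. (if l = i then 1 else 0) * H $$ (l, j)) =
        (\<Sum>l<dim_row H. if l = i then H $$ (l, j) else 0)" by (rule sum.cong) auto
  thus "H $$ (i, j) = (\<Sum>l<dim_row H. (if l = i then 1 else 0) * H $$ (l, j))" using assms by simp
qed

lemma in_row_lattice_diff:
  assumes "in_row_lattice H v" "in_row_lattice H w"
  shows "in_row_lattice H (\<lambda>j. v j - w j)"
proof -
  obtain a b where "\<forall>j<dim_col H. v j = (\<Sum>l<dim_row H. a l * H $$ (l, j))"
    "\<forall>j<dim_col H. w j = (\<Sum>l<dim_row H. b l * H $$ (l, j))"
    using assms by (auto simp: in_row_lattice_def)
  thus ?thesis unfolding in_row_lattice_def
    by (intro exI[of _ "\<lambda>l. a l - b l"]) (simp add: left_diff_distrib sum_subtractf)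
qed

lemma in_row_lattice_row_equiv:
  assumes A: "A \<in> carrier_mat r n" and e: "row_equiv A H" and w: "in_row_lattice A w"
  shows "in_row_lattice H w"
proof -
  obtain P where P: "P \<in> carrier_mat r r" and AP: "A = P * H" and H: "H \<in> carrier_mat r n"
    using row_equivE[OF e A] by metis
  obtain a where a: "\<And>j. j < n \<Longrightarrow> w j = (\<Sum>i<r. a i * A $$ (i, j))"
    using w A by (auto simp: in_row_lattice_def)
  have "w j = (\<Sum>l<r. (\<Sum>i<r. a i * P $$ (i, l)) * H $$ (l, j))" if j: "j < n" for j
  proof -
    have "w j = (\<Sum>i<r. a i * (\<Sum>l<r. P $$ (i, l) * H $$ (l, j)))"
      unfolding a[OF j] by (rule sum.cong) (use AP index_mult_mat_sum[OF P H _ j] in auto)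
    also have "\<dots> = (\<Sum>i<r. \<Sum>l<r. a i * P $$ (i, l) * H $$ (l, j))"
      by (simp add: sum_distrib_left mult.assoc)
    also have "\<dots> = (\<Sum>l<r. \<Sum>i<r. a i * P $$ (i, l) * H $$ (l, j))" by (rule sum.swap)
    finally show ?thesis by (simp add: sum_distrib_right)
  qed
  thus ?thesis using H unfolding in_row_lattice_def by auto
qed

text \<open>Let \<open>k\<close> be the first row with a nonzero coefficient in an integer combination of the rows. Up to
  and including the pivot column of row \<open>k\<close> all later rows vanish, so there the combination is just a
  multiple of row \<open>k\<close>. Its leading entry therefore sits in a pivot column and is a multiple
  of the pivot. Uniqueness of the normal form and the inheritance of a splitting both rest on this.\<close>

lemma row_lattice_leading_entry:
  assumes pre: "hermite_prefix H n r c" and H: "H \<in> carrier_mat r n"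
    and w: "in_row_lattice H w" and nz: "j < n" "w j \<noteq> 0"
  obtains k where "k < r" "w (c k) \<noteq> 0" "H $$ (k, c k) dvd w (c k)" "\<And>l. l < c k \<Longrightarrow> w l = 0"
proof -
  obtain a where a: "\<And>j. j < n \<Longrightarrow> w j = (\<Sum>l<r. a l * H $$ (l, j))"
    using w H by (auto simp: in_row_lattice_def)
  have "\<exists>l<r. a l \<noteq> 0"
  proof (rule ccontr)
    assume "\<not> (\<exists>l<r. a l \<noteq> 0)"
    thus False using a[OF nz(1)] nz(2) by simp
  qed
  then obtain k where k: "k < r" "a k \<noteq> 0" and "\<And>l. l < k \<Longrightarrow> \<not> (l < r \<and> a l \<noteq> 0)"
    using exists_least_iff[of "\<lambda>l. l < r \<and> a l \<noteq> 0"] by auto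
  hence least: "\<And>l. l < k \<Longrightarrow> a l = 0" by (meson order.strict_trans)
  have ck: "c k < n" "H $$ (k, c k) > 0" "\<And>l. l < c k \<Longrightarrow> H $$ (k, l) = 0"
    using pre k by (auto simp: hermite_prefix_def)
  have w_eq: "w l = a k * H $$ (k, l)" if "l \<le> c k" for l
  proof -
    have "a i * H $$ (i, l) = 0" if i: "i < r" "i \<noteq> k" for i
    proof (cases "i < k")
      case False
      hence "c k < c i" using pre i k by (auto simp: hermite_prefix_def strict_mono_on_def)
      thus ?thesis using pre i \<open>l \<le> c k\<close> by (auto simp: hermite_prefix_def)
    qed (simp add: least)
    hence "(\<Sum>i<r. a i * H $$ (i, l)) = (\<Sum>i<r. if i = k then a k * H $$ (k, l) else 0)"
      by (intro sum.cong) auto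
    thus ?thesis using a[of l] that ck k by simp
  qed
  show thesis by (rule that[of k]) (use k ck w_eq in auto)
qed

text \<open>A nonzero lattice vector has in some pivot column a nonzero multiple of the pivot. This is how the
  bound on the entries above the pivots is exploited: such entries, and differences of
  two of them, are smaller in absolute value than the pivot.\<close>

lemma row_lattice_zero_if_small_at_pivots:
  assumes pre: "hermite_prefix H n r c" and H: "H \<in> carrier_mat r n"
    and w: "in_row_lattice H w" and small: "\<And>k. k < r \<Longrightarrow> \<bar>w (c k)\<bar> < H $$ (k, c k)"
    and j: "j < n"
  shows "w j = 0"
proof (rule ccontr)
  assume "w j \<noteq> 0"
  then obtain k where k: "k < r" "w (c k) \<noteq> 0" "H $$ (k, c k) dvd w (c k)"
    using row_lattice_leading_entry[OF pre H w j] by metis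
  thus False using small[OF k(1)] dvd_imp_le_int[OF k(2,3)] by auto
qed

lemma strict_mono_on_lessThan_ge_id:
  fixes g :: "nat \<Rightarrow> nat"
  assumes "strict_mono_on {..<r} g" "i < r" shows "i \<le> g i"
  using assms(2)
proof (induction i)
  case (Suc i)
  hence "g i < g (Suc i)" using assms(1) by (auto simp: strict_mono_on_def)
  thus ?case using Suc by auto
qed simp

text \<open>Each row of \<open>H'\<close> lies in the row lattice of \<open>H\<close>, so its pivot column is a pivot column \<open>c (g i)\<close> of
  \<open>H\<close>. The map \<open>g\<close> is strictly increasing, hence \<open>i \<le> g i\<close> and \<open>c i \<le> c' i\<close>; equality forces
  \<open>g i = i\<close>, and then the pivot of \<open>H\<close> divides that of \<open>H'\<close>.\<close>

lemma hermite_pivot_le: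
  assumes H: "H \<in> carrier_mat r n" and pre: "hermite_prefix H n r c"
    and H': "H' \<in> carrier_mat r n" and pre': "hermite_prefix H' n r c'"
    and e: "row_equiv H' H" and i: "i < r"
  shows "c i \<le> c' i" and "c i = c' i \<Longrightarrow> H $$ (i, c i) dvd H' $$ (i, c' i)"
proof -
  have ex: "\<exists>k<r. c' i = c k \<and> H $$ (k, c k) dvd H' $$ (i, c' i)" if i: "i < r" for i
  proof -
    have L: "in_row_lattice H (\<lambda>j. H' $$ (i, j))"
      using in_row_lattice_row_equiv[OF H' e in_row_lattice_row] H' i by auto
    have piv': "c' i < n" "H' $$ (i, c' i) > 0" "\<And>l. l < c' i \<Longrightarrow> H' $$ (i, l) = 0"
      using pre' i by (auto simp: hermite_prefix_def)
    obtain k where k: "k < r" "H' $$ (i, c k) \<noteq> 0" "H $$ (k, c k) dvd H' $$ (i, c k)"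
      "\<And>l. l < c k \<Longrightarrow> H' $$ (i, l) = 0"
      using row_lattice_leading_entry[OF pre H L piv'(1)] piv'(2) by auto
    have "c' i = c k" using k(2,4) piv' by (metis less_irrefl linorder_neqE_nat)
    thus ?thesis using k by auto
  qed
  then obtain g where g: "\<And>i. i < r \<Longrightarrow> g i < r" "\<And>i. i < r \<Longrightarrow> c' i = c (g i)"
    "\<And>i. i < r \<Longrightarrow> H $$ (g i, c (g i)) dvd H' $$ (i, c' i)" by metis
  have m: "strict_mono_on {..<r} c" "strict_mono_on {..<r} c'"
    using pre pre' by (auto simp: hermite_prefix_def)
  have less: "c x < c y \<longleftrightarrow> x < y" if "x < r" "y < r" for x y
    using strict_mono_on_less[OF m(1)] that by auto
  have "strict_mono_on {..<r} g"
  proof (rule strict_mono_onI)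
    fix x y assume "x \<in> {..<r}" "y \<in> {..<r}" "x < y"
    thus "g x < g y" using strict_mono_onD[OF m(2), of x y] g(1,2) less by auto
  qed
  hence "i \<le> g i" using i by (rule strict_mono_on_lessThan_ge_id)
  thus "c i \<le> c' i" using g(1,2)[OF i] i less[of "g i" i] by (metis linorder_not_less)
  assume "c i = c' i"
  hence "g i = i" using g(1,2)[OF i] i less[of i "g i"] less[of "g i" i]
    by (metis less_irrefl linorder_neqE_nat)
  thus "H $$ (i, c i) dvd H' $$ (i, c' i)" using g(3)[OF i] by simp
qed

text \<open>By symmetry the two pivot sequences and the pivots themselves agree. The difference of two
  corresponding rows is a lattice vector: it vanishes up to the pivot column of that row, and in later
  pivot columns it is a difference of two reduced entries. So it is small at all pivots, hence zero.\<close>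

lemma hermite_form_unique:
  assumes H: "H \<in> carrier_mat r n" and pre: "hermite_prefix H n r c"
    and H': "H' \<in> carrier_mat r n" and pre': "hermite_prefix H' n r c'"
    and e: "row_equiv H H'" and e': "row_equiv H' H"
  shows "H = H'"
proof -
  have c: "c i = c' i" if "i < r" for i
    using hermite_pivot_le(1)[OF H pre H' pre' e' that] hermite_pivot_le(1)[OF H' pre' H pre e that]
    by simp
  have pos: "H $$ (i, c i) > 0" "H' $$ (i, c i) > 0" if "i < r" for i
    using pre pre' c[OF that] that by (auto simp: hermite_prefix_def)
  have piv: "H $$ (i, c i) = H' $$ (i, c i)" if "i < r" for i
    using hermite_pivot_le(2)[OF H pre H' pre' e' that] hermite_pivot_le(2)[OF H' pre' H pre e that]
      c[OF that] pos[OF that] by (auto intro: zdvd_antisym_nonneg)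
  have "H $$ (i, j) - H' $$ (i, j) = 0" if i: "i < r" and j: "j < n" for i j
  proof (rule row_lattice_zero_if_small_at_pivots[OF pre H _ _ j])
    show "in_row_lattice H (\<lambda>j. H $$ (i, j) - H' $$ (i, j))"
      using in_row_lattice_row_equiv[OF H' e' in_row_lattice_row] H' H i
      by (intro in_row_lattice_diff in_row_lattice_row) auto
    fix k assume k: "k < r"
    consider "k < i" | "k = i" | "i < k" by linarith
    thus "\<bar>H $$ (i, c k) - H' $$ (i, c k)\<bar> < H $$ (k, c k)"
    proof cases
      case 1
      hence "c k < c i" using pre i k by (auto simp: hermite_prefix_def strict_mono_on_def)
      thus ?thesis using pre pre' i c[OF i] pos[OF k] by (auto simp: hermite_prefix_def)
    next
      case 2
      thus ?thesis using piv[OF i] pos[OF i] by simp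
    next
      case 3
      hence "0 \<le> H $$ (i, c k)" "H $$ (i, c k) < H $$ (k, c k)"
        "0 \<le> H' $$ (i, c k)" "H' $$ (i, c k) < H $$ (k, c k)"
        using hermite_prefixD(5)[OF pre k 3] hermite_prefixD(5)[OF pre' k 3] c[OF k] piv[OF k] by simp_all
      thus ?thesis by linarith
    qed
  qed
  thus ?thesis using H H' by (intro eq_matI) auto
qed

lemma is_hnf_of_iff:
  assumes A: "A \<in> carrier_mat r n" and rk: "int_rank A = r"
  shows "is_hnf_of A H \<longleftrightarrow> row_equiv A H \<and> (\<exists>c. hermite_prefix H n r c)"
  using A rk unfolding is_hnf_of_def row_equiv_iff_unimodular hermite_prefix_def Let_def by auto

text \<open>Existence and uniqueness make the definite description in \<^const>\<open>hnf\<close> meaningful.\<close>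

lemma hnf_full_row_rank:
  assumes A: "A \<in> carrier_mat r n" and rk: "int_rank A = r"
  obtains c where "row_equiv A (hnf A)" "hermite_prefix (hnf A) n r c"
proof -
  have "\<exists>!H. is_hnf_of A H"
  proof (rule ex_ex1I)
    obtain H k c where H: "row_equiv A H" "hermite_prefix H n k c" using ex_hermite_form[OF A] by blast
    with hermite_prefix_full_row_rank[OF A rk H] show "\<exists>H. is_hnf_of A H"
      unfolding is_hnf_of_iff[OF A rk] by auto
  next
    fix H H' assume "is_hnf_of A H" "is_hnf_of A H'"
    then obtain c c' where *: "row_equiv A H" "row_equiv A H'"
      "hermite_prefix H n r c" "hermite_prefix H' n r c'" unfolding is_hnf_of_iff[OF A rk] by auto
    have "H \<in> carrier_mat r n" "H' \<in> carrier_mat r n" using * A row_equiv_dims by auto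
    thus "H = H'"
      using hermite_form_unique *(3,4) row_equiv_euclidean[OF A *(1,2)] row_equiv_euclidean[OF A *(2,1)]
      by metis
  qed
  hence "is_hnf_of A (hnf A)" unfolding hnf_def by (rule theI')
  thus thesis using that unfolding is_hnf_of_iff[OF A rk] by auto
qed

section \<open>Splitting the rows along a set of columns\<close>

text \<open>Block-diagonal shape, up to permutations of rows and columns, with \<open>S\<close> as the column set of one
  block; a block may still lack rows.\<close>

definition rows_split :: "int mat \<Rightarrow> nat set \<Rightarrow> bool" where
  "rows_split M S \<longleftrightarrow>
     (\<forall>i<dim_row M. \<forall>j<dim_col M. \<forall>l<dim_col M. j \<in> S \<longrightarrow> l \<notin> S \<longrightarrow> M $$ (i, j) = 0 \<or> M $$ (i, l) = 0)"

text \<open>Suppose that columns on different sides of \<open>S\<close> are orthogonal, and let \<open>j\<close> lie on the other side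
  than the pivot column \<open>c i\<close>. In the scalar product of columns \<open>c i\<close> and \<open>j\<close> the rows after \<open>i\<close> contribute
  nothing, because column \<open>c i\<close> vanishes there. A row \<open>k < i\<close> contributes nothing either: by induction it
  vanishes on the side that does not contain \<open>c k\<close>, and \<open>c i\<close> or \<open>j\<close> is on that side. What remains is the
  pivot times the entry \<open>(i, j)\<close>, so this entry is zero.\<close>

lemma gram_orthogonal_imp_zero:
  assumes pre: "hermite_prefix H n r c" and H: "H \<in> carrier_mat r n"
    and orth: "\<And>j l. j < n \<Longrightarrow> l < n \<Longrightarrow> (j \<in> S) \<noteq> (l \<in> S) \<Longrightarrow> (\<Sum>i<r. H $$ (i, j) * H $$ (i, l)) = 0"
    and "i < r" "j < n" "(j \<in> S) \<noteq> (c i \<in> S)"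
  shows "H $$ (i, j) = 0"
  using assms(4-6)
proof (induction i arbitrary: j rule: less_induct)
  case (less i)
  have ci: "c i < n" "H $$ (i, c i) > 0" using hermite_prefixD[OF pre less.prems(1)] by auto
  have "H $$ (k, c i) * H $$ (k, j) = 0" if k: "k < r" "k \<noteq> i" for k
  proof (cases "k < i")
    case True
    show ?thesis
    proof (cases "(c k \<in> S) = (c i \<in> S)")
      case same: True
      thus ?thesis using less.IH[OF True k(1) less.prems(2)] less.prems(3) by simp
    next
      case False
      thus ?thesis using less.IH[OF True k(1) ci(1)] by simp
    qed
  next
    case False
    hence "c i < c k" using hermite_prefixD(4)[OF pre k(1), of i] k by simp
    thus ?thesis using hermite_prefixD(2)[OF pre k(1)] by simp
  qed
  hence "(\<Sum>k<r. H $$ (k, c i) * H $$ (k, j)) = (\<Sum>k<r. if k = i then H $$ (i, c i) * H $$ (i, j) else 0)"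
    by (intro sum.cong) auto
  hence "H $$ (i, c i) * H $$ (i, j) = 0" using orth[OF ci(1) less.prems(2)] less.prems by simp
  thus ?case using ci by simp
qed

lemma rows_split_iff_gram:
  assumes pre: "hermite_prefix H n r c" and H: "H \<in> carrier_mat r n"
  shows "rows_split H S \<longleftrightarrow>
    (\<forall>j<n. \<forall>l<n. j \<in> S \<longrightarrow> l \<notin> S \<longrightarrow> (H\<^sup>T * H) $$ (j, l) = 0)"
proof -
  have gram: "(H\<^sup>T * H) $$ (j, l) = (\<Sum>i<r. H $$ (i, j) * H $$ (i, l))" if "j < n" "l < n" for j l
    using H that by (auto simp: scalar_prod_def atLeast0LessThan)
  show ?thesis
  proof
    assume split: "rows_split H S"
    have "H $$ (i, j) * H $$ (i, l) = 0" if "i < r" "j < n" "l < n" "j \<in> S" "l \<notin> S" for i j l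
      using split H that by (auto simp: rows_split_def)
    thus "\<forall>j<n. \<forall>l<n. j \<in> S \<longrightarrow> l \<notin> S \<longrightarrow> (H\<^sup>T * H) $$ (j, l) = 0"
      by (simp add: gram del: index_mult_mat mult_eq_0_iff)
  next
    assume z: "\<forall>j<n. \<forall>l<n. j \<in> S \<longrightarrow> l \<notin> S \<longrightarrow> (H\<^sup>T * H) $$ (j, l) = 0"
    have orth: "(\<Sum>i<r. H $$ (i, j) * H $$ (i, l)) = 0" if "j < n" "l < n" "(j \<in> S) \<noteq> (l \<in> S)" for j l
    proof (cases "j \<in> S")
      case True
      thus ?thesis using z gram[of j l] that by simp
    next
      case False
      thus ?thesis using z gram[of l j] that by (simp add: mult.commute)
    qed
    have "H $$ (i, j) = 0" if "i < r" "j < n" "(j \<in> S) \<noteq> (c i \<in> S)" for i j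
      using gram_orthogonal_imp_zero[where S = S, OF pre H _ that] orth by blast
    thus "rows_split H S" using H unfolding rows_split_def by (metis carrier_matD)
  qed
qed

text \<open>Keeping only the summands that belong to rows supported in \<open>S\<close> projects an integer combination of
  rows onto the coordinates in \<open>S\<close>.\<close>

lemma rows_split_restrict_in_lattice:
  assumes "rows_split M S" "in_row_lattice M w"
  shows "in_row_lattice M (\<lambda>j. if j \<in> S then w j else 0)"
proof -
  obtain a where a: "\<And>j. j < dim_col M \<Longrightarrow> w j = (\<Sum>l<dim_row M. a l * M $$ (l, j))"
    using assms(2) by (auto simp: in_row_lattice_def)
  \<comment> \<open>the rows that are nonzero somewhere in S, and hence vanish outside S\<close>
  define T where "T = {l. \<exists>j<dim_col M. j \<in> S \<and> M $$ (l, j) \<noteq> 0}"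
  have "(if j \<in> S then w j else 0) = (\<Sum>l<dim_row M. (if l \<in> T then a l else 0) * M $$ (l, j))"
    if j: "j < dim_col M" for j
  proof (cases "j \<in> S")
    case True
    hence "a l * M $$ (l, j) = (if l \<in> T then a l else 0) * M $$ (l, j)" for l
      using j by (auto simp: T_def)
    thus ?thesis using True unfolding a[OF j] by (auto intro: sum.cong)
  next
    case False
    hence "(if l \<in> T then a l else 0) * M $$ (l, j) = 0" if "l < dim_row M" for l
      using assms(1) j that by (auto simp: T_def rows_split_def)
    hence "(\<Sum>l<dim_row M. (if l \<in> T then a l else 0) * M $$ (l, j)) = 0"
      by (intro sum.neutral) auto
    thus ?thesis using False by simp
  qed
  thus ?thesis unfolding in_row_lattice_def
    by (intro exI[of _ "\<lambda>l. if l \<in> T then a l else 0"] allI impI)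
qed

text \<open>Both projections of a row \<open>i\<close> of \<open>H\<close>, onto \<open>S\<close> and onto its complement, belong to the common row
  lattice of \<open>M\<close> and \<open>H\<close>. Take the projection that loses the pivot column \<open>c i\<close>. At every other
  pivot column it is zero or equal to the entry of \<open>H\<close>, and the latter is zero in earlier pivot columns
  and reduced in later ones. So this projection is small at all pivots and
  vanishes.\<close>

lemma rows_split_hermite:
  assumes M: "M \<in> carrier_mat r n" and split: "rows_split M S"
    and H: "H \<in> carrier_mat r n" and pre: "hermite_prefix H n r c"
    and e: "row_equiv M H" and e': "row_equiv H M"
  shows "rows_split H S"
proof -
  have restr: "in_row_lattice H (\<lambda>j. if j \<in> S then H $$ (i, j) else 0)" if "i < r" for i
    using rows_split_restrict_in_lattice[OF split in_row_lattice_row_equiv[OF H e' in_row_lattice_row]]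
      in_row_lattice_row_equiv[OF M e] that H by auto
  have vanish: "w j = 0"
    if i: "i < r" and j: "j < n" and w: "in_row_lattice H w" and ci: "w (c i) = 0"
      and sub: "\<And>l. w l = 0 \<or> w l = H $$ (i, l)" for i j w
  proof (rule row_lattice_zero_if_small_at_pivots[OF pre H w _ j])
    fix k assume k: "k < r"
    consider "k < i" | "k = i" | "i < k" by linarith
    thus "\<bar>w (c k)\<bar> < H $$ (k, c k)"
    proof cases
      case 1
      hence "H $$ (i, c k) = 0" using hermite_prefixD(2,4)[OF pre i] by simp
      thus ?thesis using sub[of "c k"] hermite_prefixD(3)[OF pre k] by auto
    next
      case 2
      thus ?thesis using ci hermite_prefixD(3)[OF pre k] by simp
    next
      case 3
      thus ?thesis using sub[of "c k"] hermite_prefixD(3,5)[OF pre k] by fastforce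
    qed
  qed
  have "H $$ (i, j) = 0 \<or> H $$ (i, l) = 0"
    if i: "i < r" and j: "j < n" "j \<in> S" and l: "l < n" "l \<notin> S" for i j l
  proof (cases "c i \<in> S")
    case True
    let ?w = "\<lambda>j. H $$ (i, j) - (if j \<in> S then H $$ (i, j) else 0)"
    have "?w l = 0"
      by (rule vanish[OF i l(1) in_row_lattice_diff[OF in_row_lattice_row restr[OF i]]])
         (use True i H in auto)
    thus ?thesis using l by simp
  next
    case False
    have "(if j \<in> S then H $$ (i, j) else 0) = 0"
      by (rule vanish[OF i j(1) restr[OF i]]) (use False in auto)
    thus ?thesis using j by simp
  qed
  thus ?thesis using H by (auto simp: rows_split_def)
qed

section \<open>Permutation matrices and direct sums\<close>

text \<open>The matrix whose column \<open>j\<close> is the unit vector with index \<open>p j\<close>, so that multiplying with it from the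
  right moves column \<open>p j\<close> to position \<open>j\<close>.\<close>

definition perm_mat :: "nat \<Rightarrow> (nat \<Rightarrow> nat) \<Rightarrow> int mat" where
  "perm_mat n p = mat n n (\<lambda>(i, j). if i = p j then 1 else 0)"

lemma perm_mat_carrier [simp]: "perm_mat n p \<in> carrier_mat n n"
  by (simp add: perm_mat_def)

lemma permutation_mat_iff:
  "Q \<in> carrier_mat n n \<and> permutation_mat Q \<longleftrightarrow> (\<exists>p. p permutes {..<n} \<and> Q = perm_mat n p)"
  by (auto simp: permutation_mat_def perm_mat_def)

lemma permutes_lessThan_less: "p permutes {..<n} \<Longrightarrow> i < n \<Longrightarrow> p i < (n :: nat)"
  using permutes_in_image[of p "{..<n}" i] by simp

lemma index_mult_perm_mat:
  assumes "M \<in> carrier_mat r n" "p permutes {..<n}" "i < r" "j < n"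
  shows "(M * perm_mat n p) $$ (i, j) = M $$ (i, p j)"
proof -
  have "(M * perm_mat n p) $$ (i, j) = (\<Sum>k<n. M $$ (i, k) * perm_mat n p $$ (k, j))"
    by (rule index_mult_mat_sum[OF assms(1) _ assms(3,4)]) simp
  also have "\<dots> = (\<Sum>k<n. if k = p j then M $$ (i, k) else 0)"
    by (rule sum.cong) (use assms in \<open>auto simp: perm_mat_def\<close>)
  finally show ?thesis using permutes_lessThan_less[OF assms(2,4)] by simp
qed

lemma index_transpose_perm_mat_mult:
  assumes "M \<in> carrier_mat n m" "p permutes {..<n}" "i < n" "j < m"
  shows "((perm_mat n p)\<^sup>T * M) $$ (i, j) = M $$ (p i, j)"
proof -
  have "((perm_mat n p)\<^sup>T * M) $$ (i, j) = (\<Sum>k<n. (perm_mat n p)\<^sup>T $$ (i, k) * M $$ (k, j))"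
    by (rule index_mult_mat_sum[OF _ assms(1,3,4)]) simp
  also have "\<dots> = (\<Sum>k<n. if k = p i then M $$ (k, j) else 0)"
    by (rule sum.cong) (use assms in \<open>auto simp: perm_mat_def\<close>)
  finally show ?thesis using permutes_lessThan_less[OF assms(2,3)] by simp
qed

lemma perm_mat_inverse:
  assumes p: "p permutes {..<n}"
  shows "(perm_mat n p)\<^sup>T * perm_mat n p = 1\<^sub>m n" and "perm_mat n p * (perm_mat n p)\<^sup>T = 1\<^sub>m n"
proof -
  have inj: "p i = p j \<longleftrightarrow> i = j" for i j using permutes_inj[OF p] by (auto dest: injD)
  show "(perm_mat n p)\<^sup>T * perm_mat n p = 1\<^sub>m n"
  proof (rule eq_matI)
    fix i j assume "i < dim_row (1\<^sub>m n :: int mat)" "j < dim_col (1\<^sub>m n :: int mat)"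
    hence ij: "i < n" "j < n" by auto
    show "((perm_mat n p)\<^sup>T * perm_mat n p) $$ (i, j) = 1\<^sub>m n $$ (i, j)"
      unfolding index_transpose_perm_mat_mult[OF perm_mat_carrier p ij]
      using ij permutes_lessThan_less[OF p] by (simp add: perm_mat_def inj)
  qed (auto simp: perm_mat_def)
  have q: "inv_into UNIV p permutes {..<n}" by (rule permutes_inv[OF p])
  have eq: "i = p j \<longleftrightarrow> inv_into UNIV p i = j" for i j using permutes_inverses[OF p] by auto
  have "(perm_mat n p)\<^sup>T = perm_mat n (inv_into UNIV p)"
    by (rule eq_matI) (auto simp: perm_mat_def eq)
  moreover have "perm_mat n p * perm_mat n (inv_into UNIV p) = 1\<^sub>m n"
  proof (rule eq_matI)
    fix i j assume "i < dim_row (1\<^sub>m n :: int mat)" "j < dim_col (1\<^sub>m n :: int mat)"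
    hence ij: "i < n" "j < n" by auto
    show "(perm_mat n p * perm_mat n (inv_into UNIV p)) $$ (i, j) = 1\<^sub>m n $$ (i, j)"
      unfolding index_mult_perm_mat[OF perm_mat_carrier q ij]
      using ij permutes_lessThan_less[OF q] permutes_inverses[OF p] by (simp add: perm_mat_def)
  qed (auto simp: perm_mat_def)
  ultimately show "perm_mat n p * (perm_mat n p)\<^sup>T = 1\<^sub>m n" by simp
qed

lemma ex_permutation_to_front:
  fixes S :: "nat set"
  assumes "S \<subseteq> {..<n}"
  obtains p where "p permutes {..<n}" "\<And>i. i < n \<Longrightarrow> p i \<in> S \<longleftrightarrow> i < card S"
proof -
  have fin: "finite S" and le: "card S \<le> n"
    using assms finite_subset card_mono[of "{..<n}" S] by auto
  have "card {card S..<n} = card ({..<n} - S)" using assms fin by (simp add: card_Diff_subset)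
  then obtain g where g: "bij_betw g {card S..<n} ({..<n} - S)"
    using finite_same_card_bij[of "{card S..<n}" "{..<n} - S"] by auto
  obtain f where f: "bij_betw f {..<card S} S"
    using finite_same_card_bij[of "{..<card S}" S] fin by auto
  define p where "p = (\<lambda>i. if i < card S then f i else if i < n then g i else i)"
  have pf: "bij_betw p {..<card S} S" and pg: "bij_betw p {card S..<n} ({..<n} - S)"
    using bij_betw_cong[of "{..<card S}" p f] bij_betw_cong[of "{card S..<n}" p g] f g
    by (auto simp: p_def)
  have "bij_betw p ({..<card S} \<union> {card S..<n}) (S \<union> ({..<n} - S))"
    by (rule bij_betw_combine[OF pf pg]) auto
  moreover have "{..<card S} \<union> {card S..<n} = {..<n}" "S \<union> ({..<n} - S) = {..<n}"
    using le assms by auto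
  ultimately have "bij_betw p {..<n} {..<n}" by simp
  hence "p permutes {..<n}" by (rule bij_imp_permutes) (use le in \<open>auto simp: p_def\<close>)
  moreover have "p i \<in> S \<longleftrightarrow> i < card S" if "i < n" for i
    using that bij_betwE[OF pf] bij_betwE[OF pg] by (cases "i < card S") auto
  ultimately show thesis using that by blast
qed

text \<open>The first block of a direct sum of at least two nonempty blocks is a corner, and what follows forms a
  second nonempty corner; so two blocks always suffice.\<close>

lemma diag_block_mat_split:
  assumes "length Bs \<ge> 2" "\<forall>B \<in> set Bs. nonempty_mat B"
  defines "M \<equiv> diag_block_mat Bs" and "a \<equiv> dim_row (hd Bs)" and "b \<equiv> dim_col (hd Bs)"
  shows "0 < a \<and> a < dim_row M \<and> 0 < b \<and> b < dim_col M \<and>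
    (\<forall>i<dim_row M. \<forall>j<dim_col M. (i < a) \<noteq> (j < b) \<longrightarrow> M $$ (i, j) = 0)"
proof -
  obtain B C Bs' where Bs: "Bs = B # C # Bs'"
    using assms(1) by (cases Bs; cases "tl Bs") auto
  have M: "M = four_block_mat B (0\<^sub>m (dim_row B) (dim_col (diag_block_mat (C # Bs'))))
      (0\<^sub>m (dim_row (diag_block_mat (C # Bs'))) (dim_col B)) (diag_block_mat (C # Bs'))"
    unfolding M_def Bs diag_block_mat.simps(2)[of B] Let_def ..
  have "dim_row (diag_block_mat (C # Bs')) > 0" "dim_col (diag_block_mat (C # Bs')) > 0"
    "dim_row B > 0" "dim_col B > 0"
    using assms(2) unfolding Bs dim_diag_block_mat by (auto simp: nonempty_mat_def)
  thus ?thesis unfolding M a_def b_def Bs by (auto simp: Let_def)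
qed

lemma diag_block_mat_two_blocks:
  fixes M :: "int mat"
  assumes "a \<le> dim_row M" "b \<le> dim_col M"
    and "\<And>i j. i < dim_row M \<Longrightarrow> j < dim_col M \<Longrightarrow> (i < a) \<noteq> (j < b) \<Longrightarrow> M $$ (i, j) = 0"
  shows "M = diag_block_mat [mat a b (\<lambda>(i, j). M $$ (i, j)),
      mat (dim_row M - a) (dim_col M - b) (\<lambda>(i, j). M $$ (i + a, j + b))]"
  by (rule eq_matI) (use assms in \<open>auto simp: Let_def\<close>)

lemma decomposes_direct_sum_iff:
  "decomposes_direct_sum M \<longleftrightarrow>
     (\<exists>a b. 0 < a \<and> a < dim_row M \<and> 0 < b \<and> b < dim_col M \<and>
       (\<forall>i<dim_row M. \<forall>j<dim_col M. (i < a) \<noteq> (j < b) \<longrightarrow> M $$ (i, j) = 0))"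
    (is "_ \<longleftrightarrow> ?R")
proof
  assume "decomposes_direct_sum M"
  then obtain Bs where "length Bs \<ge> 2" "\<forall>B \<in> set Bs. nonempty_mat B" "M = diag_block_mat Bs"
    by (auto simp: decomposes_direct_sum_def)
  thus ?R using diag_block_mat_split[of Bs] by blast
next
  assume ?R
  then obtain a b where ab: "0 < a" "a < dim_row M" "0 < b" "b < dim_col M"
    "\<And>i j. i < dim_row M \<Longrightarrow> j < dim_col M \<Longrightarrow> (i < a) \<noteq> (j < b) \<Longrightarrow> M $$ (i, j) = 0" by blast
  define B where "B = mat a b (\<lambda>(i, j). M $$ (i, j))"
  define C where "C = mat (dim_row M - a) (dim_col M - b) (\<lambda>(i, j). M $$ (i + a, j + b))"
  have "M = diag_block_mat [B, C]"
    unfolding B_def C_def using ab by (intro diag_block_mat_two_blocks) auto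
  moreover have "nonempty_mat B" "nonempty_mat C"
    using ab by (auto simp: nonempty_mat_def B_def C_def)
  ultimately show "decomposes_direct_sum M" unfolding decomposes_direct_sum_def
    by (intro exI[of _ "[B, C]"]) auto
qed

lemma decomposes_direct_sum_square_iff:
  assumes "square_mat M"
  shows "decomposes_direct_sum_square M \<longleftrightarrow>
     (\<exists>a. 0 < a \<and> a < dim_row M \<and>
       (\<forall>i<dim_row M. \<forall>j<dim_row M. (i < a) \<noteq> (j < a) \<longrightarrow> M $$ (i, j) = 0))"
    (is "_ \<longleftrightarrow> ?R")
proof
  assume "decomposes_direct_sum_square M"
  then obtain Bs where Bs: "length Bs \<ge> 2" "\<forall>B \<in> set Bs. nonempty_mat B" "M = diag_block_mat Bs"
    "\<forall>B \<in> set Bs. square_mat B"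
    by (auto simp: decomposes_direct_sum_square_def)
  hence "dim_col (hd Bs) = dim_row (hd Bs)" by (cases Bs) auto
  thus ?R using diag_block_mat_split[OF Bs(1,2)] Bs(3) assms by auto
next
  assume ?R
  then obtain a where a: "0 < a" "a < dim_row M"
    "\<And>i j. i < dim_row M \<Longrightarrow> j < dim_row M \<Longrightarrow> (i < a) \<noteq> (j < a) \<Longrightarrow> M $$ (i, j) = 0" by blast
  define B where "B = mat a a (\<lambda>(i, j). M $$ (i, j))"
  define C where "C = mat (dim_row M - a) (dim_col M - a) (\<lambda>(i, j). M $$ (i + a, j + a))"
  have "M = diag_block_mat [B, C]"
    unfolding B_def C_def using a assms by (intro diag_block_mat_two_blocks) auto
  moreover have "nonempty_mat B" "nonempty_mat C" "square_mat B" "square_mat C"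
    using a assms by (auto simp: nonempty_mat_def B_def C_def)
  ultimately show "decomposes_direct_sum_square M" unfolding decomposes_direct_sum_square_def
    by (intro exI[of _ "[B, C]"]) auto
qed

section \<open>Reducibility and decomposability as splittings\<close>

text \<open>Here \<open>S\<close> is the image of \<open>{..<b}\<close> under \<open>p\<close>: the set of original column indices that the permutation
  brings into the first block.\<close>

lemma permutes_preimage_proper:
  fixes b n :: nat
  assumes p: "p permutes {..<n}" and b: "0 < b" "b < n"
  defines "S \<equiv> {i. i < n \<and> inv_into UNIV p i < b}"
  shows "S \<noteq> {}" "S \<subset> {..<n}"
proof -
  have mem: "p i \<in> S \<longleftrightarrow> i < b" if "i < n" for i
    using that permutes_lessThan_less[OF p that] permutes_inverses(2)[OF p] by (simp add: S_def)
  have "p 0 \<in> S" "p b \<notin> S" "p b < n" using mem b permutes_lessThan_less[OF p b(2)] by auto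
  thus "S \<noteq> {}" "S \<subset> {..<n}" by (auto simp: S_def)
qed

text \<open>Conjugating with a permutation matrix renames the indices, so reducibility only asks for a
  nontrivial set of indices that \<open>B\<close> does not connect to its complement.\<close>

lemma reducible_iff_partition:
  assumes B: "B \<in> carrier_mat n n" and sym: "B\<^sup>T = B"
  shows "reducible B \<longleftrightarrow>
    (\<exists>S. S \<noteq> {} \<and> S \<subset> {..<n} \<and> (\<forall>j<n. \<forall>l<n. j \<in> S \<longrightarrow> l \<notin> S \<longrightarrow> B $$ (j, l) = 0))"
    (is "_ \<longleftrightarrow> ?R")
proof -
  have sym': "B $$ (l, j) = B $$ (j, l)" if "j < n" "l < n" for j l
    using arg_cong[OF sym, of "\<lambda>M. M $$ (j, l)"] B that by auto
  have conj: "((perm_mat n p)\<^sup>T * B * perm_mat n p) $$ (i, j) = B $$ (p i, p j)"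
    if "p permutes {..<n}" "i < n" "j < n" for p i j
    using mult_carrier_mat[of "(perm_mat n p)\<^sup>T" n n B n]
      index_mult_perm_mat[of "(perm_mat n p)\<^sup>T * B" n n p i j] B that
      index_transpose_perm_mat_mult[OF B that(1,2) permutes_lessThan_less[OF that(1,3)]] by auto
  have red: "reducible B \<longleftrightarrow> (\<exists>p a. p permutes {..<n} \<and> 0 < a \<and> a < n \<and>
      (\<forall>i<n. \<forall>j<n. (i < a) \<noteq> (j < a) \<longrightarrow> B $$ (p i, p j) = 0))"
  proof -
    have "reducible B \<longleftrightarrow> (\<exists>Q. (Q \<in> carrier_mat n n \<and> permutation_mat Q) \<and>
        decomposes_direct_sum_square (Q\<^sup>T * B * Q))"
      using B sym by (auto simp: reducible_def)
    also have "\<dots> \<longleftrightarrow> (\<exists>p. p permutes {..<n} \<and>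
        decomposes_direct_sum_square ((perm_mat n p)\<^sup>T * B * perm_mat n p))"
      unfolding permutation_mat_iff by blast
    also have "\<dots> \<longleftrightarrow> (\<exists>p. p permutes {..<n} \<and> (\<exists>a. 0 < a \<and> a < n \<and>
      (\<forall>i<n. \<forall>j<n. (i < a) \<noteq> (j < a) \<longrightarrow> B $$ (p i, p j) = 0)))"
    proof (intro ex_cong1 conj_cong refl)
      fix p assume p: "p permutes {..<n}"
      let ?M = "(perm_mat n p)\<^sup>T * B * perm_mat n p"
      have d: "?M \<in> carrier_mat n n" using B by (intro mult_carrier_mat[of _ n n]) auto
      hence "square_mat ?M" "dim_row ?M = n" by auto
      thus "decomposes_direct_sum_square ?M \<longleftrightarrow> (\<exists>a. 0 < a \<and> a < n \<and>
        (\<forall>i<n. \<forall>j<n. (i < a) \<noteq> (j < a) \<longrightarrow> B $$ (p i, p j) = 0))"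
        using conj[OF p] by (simp add: decomposes_direct_sum_square_iff del: index_mult_mat square_mat.simps)
    qed
    finally show ?thesis by blast
  qed
  show ?thesis
  proof
    assume "reducible B"
    then obtain p a where p: "p permutes {..<n}" and a: "0 < a" "a < n"
      and z: "\<And>i j. i < n \<Longrightarrow> j < n \<Longrightarrow> (i < a) \<noteq> (j < a) \<Longrightarrow> B $$ (p i, p j) = 0"
      using red by blast
    let ?q = "inv_into UNIV p"
    define S where "S = {i. i < n \<and> ?q i < a}"
    have "B $$ (j, l) = 0" if "j < n" "l < n" "j \<in> S" "l \<notin> S" for j l
      using z[of "?q j" "?q l"] that permutes_lessThan_less[OF permutes_inv[OF p]] permutes_inverses(1)[OF p]
      by (auto simp: S_def)
    moreover have "S \<noteq> {}" "S \<subset> {..<n}"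
      using permutes_preimage_proper(1,2)[OF p a] by (auto simp: S_def)
    ultimately show ?R by blast
  next
    assume ?R
    then obtain S where S: "S \<noteq> {}" "S \<subset> {..<n}"
      and z: "\<And>j l. j < n \<Longrightarrow> l < n \<Longrightarrow> j \<in> S \<Longrightarrow> l \<notin> S \<Longrightarrow> B $$ (j, l) = 0" by auto
    obtain p where p: "p permutes {..<n}" "\<And>i. i < n \<Longrightarrow> p i \<in> S \<longleftrightarrow> i < card S"
      using ex_permutation_to_front[of S n] S by blast
    have "B $$ (p i, p j) = 0" if "i < n" "j < n" "(i < card S) \<noteq> (j < card S)" for i j
    proof (cases "p i \<in> S")
      case True
      thus ?thesis using z[of "p i" "p j"] p that permutes_lessThan_less[OF p(1)] by auto
    next
      case False
      thus ?thesis using z[of "p j" "p i"] sym'[of "p i" "p j"] p that permutes_lessThan_less[OF p(1)] by auto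
    qed
    moreover have "0 < card S" "card S < n"
      using S psubset_card_mono[OF _ S(2)] finite_subset[of S "{..<n}"] by (auto simp: card_gt_0_iff)
    ultimately show "reducible B" using red p(1) by blast
  qed
qed

text \<open>The rows and the columns of a decomposition can be permuted freely: a permutation of the rows is
  absorbed into the unimodular matrix. Given a matrix \<open>M\<close> whose rows split along \<open>S\<close>, the rows that meet
  \<open>S\<close> are moved to the front. The row sets of the two blocks are both nonempty because \<open>A\<close>, and with
  it \<open>M\<close>, has no zero column, while \<open>S\<close> and its complement each contain a column.\<close>

lemma decomposable_iff_rows_split:
  assumes A: "A \<in> carrier_mat r n" and nz: "\<forall>j<n. col A j \<noteq> 0\<^sub>v r"
  shows "decomposable A \<longleftrightarrow>
    (\<exists>M S. row_equiv A M \<and> S \<noteq> {} \<and> S \<subset> {..<n} \<and> rows_split M S)"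
    (is "_ \<longleftrightarrow> ?R")
proof
  assume "decomposable A"
  then obtain P R Q where P: "P \<in> carrier_mat r r" and R: "R \<in> carrier_mat r r"
    and inv: "P * R = 1\<^sub>m r" "R * P = 1\<^sub>m r" and Q: "Q \<in> carrier_mat n n" "permutation_mat Q"
    and dec: "decomposes_direct_sum (R * A * Q)"
    using A unfolding decomposable_def inverts_mat_def by auto
  obtain p where p: "p permutes {..<n}" and Qp: "Q = perm_mat n p" using Q permutation_mat_iff by blast
  let ?q = "inv_into UNIV p"
  define M where "M = R * A"
  have M: "M \<in> carrier_mat r n" using R A by (simp add: M_def)
  have "P * M = (P * R) * A" using P R A unfolding M_def by (simp add: assoc_mult_mat[of _ r r _ r _ n])
  hence "row_equiv A M" using A inv by (intro row_equivI[OF A P R inv _ M]) simp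
  moreover
  obtain a b where ab: "0 < b" "b < n"
    and z: "\<And>i j. i < r \<Longrightarrow> j < n \<Longrightarrow> (i < a) \<noteq> (j < b) \<Longrightarrow> (M * perm_mat n p) $$ (i, j) = 0"
    using dec M unfolding decomposes_direct_sum_iff M_def[symmetric] Qp
    by (auto simp: perm_mat_def simp del: index_mult_mat(1))
  define S where "S = {i. i < n \<and> ?q i < b}"
  have "M $$ (i, j) = 0" if "i < r" "j < n" "(i < a) \<noteq> (j \<in> S)" for i j
  proof -
    have "?q j < n" using that permutes_lessThan_less[OF permutes_inv[OF p]] by simp
    thus ?thesis
      using z[of i "?q j"] index_mult_perm_mat[OF M p, of i "?q j"] that permutes_inverses(1)[OF p]
      by (simp add: S_def)
  qed
  hence "rows_split M S" using M unfolding rows_split_def by (metis carrier_matD)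
  moreover have "S \<noteq> {}" "S \<subset> {..<n}"
    using permutes_preimage_proper(1,2)[OF p ab] by (auto simp: S_def)
  ultimately show ?R by blast
next
  assume ?R
  then obtain M S where e: "row_equiv A M" and S: "S \<noteq> {}" "S \<subset> {..<n}" and split: "rows_split M S"
    by blast
  obtain P where P: "P \<in> carrier_mat r r" and AP: "A = P * M" and M: "M \<in> carrier_mat r n"
    using row_equivE[OF e A] by metis
  have colM: "\<exists>i<r. M $$ (i, j) \<noteq> 0" if j: "j < n" for j
  proof (rule ccontr)
    assume "\<not> ?thesis"
    hence "A $$ (i, j) = 0" if "i < r" for i
      using index_mult_mat_sum[OF P M that j] AP by simp
    hence "col A j = 0\<^sub>v r" using A j by (intro eq_vecI) auto
    thus False using nz j by blast
  qed
  \<comment> \<open>the rows of the first block\<close>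
  define T where "T = {i. i < r \<and> (\<exists>j\<in>S. M $$ (i, j) \<noteq> 0)}"
  have z: "M $$ (i, j) = 0" if "i < r" "j < n" "(i \<in> T) \<noteq> (j \<in> S)" for i j
    using split that M S(2) by (auto simp: T_def rows_split_def)
  obtain j0 where j0: "j0 \<in> S" "j0 < n" using S by auto
  obtain j1 where j1: "j1 \<notin> S" "j1 < n" using S by auto
  have T: "T \<noteq> {}" "T \<subset> {..<r}"
    using colM[OF j0(2)] colM[OF j1(2)] z[OF _ j0(2)] z[OF _ j1(2)] j0 j1 by (auto simp: T_def)
  obtain p where p: "p permutes {..<n}" "\<And>j. j < n \<Longrightarrow> p j \<in> S \<longleftrightarrow> j < card S"
    using ex_permutation_to_front[of S n] S by blast
  obtain t where t: "t permutes {..<r}" "\<And>i. i < r \<Longrightarrow> t i \<in> T \<longleftrightarrow> i < card T"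
    using ex_permutation_to_front[of T r] T by blast
  define W where "W = perm_mat r t"
  have W: "W \<in> carrier_mat r r" "W\<^sup>T \<in> carrier_mat r r" by (auto simp: W_def)
  note Winv = perm_mat_inverse[OF t(1), folded W_def]
  have e': "row_equiv A (W\<^sup>T * M)" by (rule row_equiv_mult[OF A e W(2,1) Winv])
  then obtain P' R' where P': "P' \<in> carrier_mat r r" and R': "R' \<in> carrier_mat r r"
    and inv: "P' * R' = 1\<^sub>m r" "R' * P' = 1\<^sub>m r" and R'A: "R' * A = W\<^sup>T * M"
    using row_equivE[OF e' A] by metis
  define N where "N = R' * A * perm_mat n p"
  have N: "N \<in> carrier_mat r n"
    unfolding N_def using mult_carrier_mat[OF mult_carrier_mat[OF R' A] perm_mat_carrier] .
  have N_index: "N $$ (i, j) = M $$ (t i, p j)" if "i < r" "j < n" for i j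
  proof -
    have "N $$ (i, j) = (W\<^sup>T * M) $$ (i, p j)"
      unfolding N_def R'A by (rule index_mult_perm_mat[OF _ p(1) that]) (use W M in auto)
    also have "\<dots> = M $$ (t i, p j)"
      unfolding W_def
      by (rule index_transpose_perm_mat_mult[OF M t(1) that(1) permutes_lessThan_less[OF p(1) that(2)]])
    finally show ?thesis .
  qed
  have "N $$ (i, j) = 0" if "i < r" "j < n" "(i < card T) \<noteq> (j < card S)" for i j
    using z[of "t i" "p j"] that N_index p t permutes_lessThan_less[OF p(1)] permutes_lessThan_less[OF t(1)]
    by auto
  moreover have "0 < card S" "card S < n" "0 < card T" "card T < r"
    using S T psubset_card_mono[OF _ S(2)] psubset_card_mono[OF _ T(2)]
      finite_subset[of S "{..<n}"] finite_subset[of T "{..<r}"] by (auto simp: card_gt_0_iff)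
  ultimately have "decomposes_direct_sum N"
    unfolding decomposes_direct_sum_iff using N by auto
  moreover have "unimodular_mat P'" using unimodular_iff_inverse[OF P'] R' inv by blast
  moreover have "permutation_mat (perm_mat n p)" using permutation_mat_iff[of "perm_mat n p" n] p(1) by blast
  ultimately show "decomposable A"
    unfolding decomposable_def inverts_mat_def N_def
    using A P' R' inv by (intro exI[of _ P'] exI[of _ R'] exI[of _ "perm_mat n p"]) auto
qed

theorem theorem2p8:
  fixes A :: "int mat" and r n :: nat
  assumes "A \<in> carrier_mat r n"
    and "int_rank A = r"
    and "\<forall>j<n. col A j \<noteq> 0\<^sub>v r"
  shows "decomposable A \<longleftrightarrow> reducible ((hnf A)\<^sup>T * hnf A)"
proof -
  note A = assms(1)
  obtain c where e: "row_equiv A (hnf A)" and pre: "hermite_prefix (hnf A) n r c"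
    using hnf_full_row_rank[OF assms(1,2)] by blast
  have H: "hnf A \<in> carrier_mat r n" using A row_equiv_dims[OF e] by auto
  have "decomposable A \<longleftrightarrow> (\<exists>M S. row_equiv A M \<and> S \<noteq> {} \<and> S \<subset> {..<n} \<and> rows_split M S)"
    by (rule decomposable_iff_rows_split[OF A assms(3)])
  also have "\<dots> \<longleftrightarrow> (\<exists>S. S \<noteq> {} \<and> S \<subset> {..<n} \<and> rows_split (hnf A) S)"
  proof -
    have "rows_split (hnf A) S" if M: "row_equiv A M" and split: "rows_split M S" for M S
    proof (rule rows_split_hermite[OF _ split H pre])
      show "M \<in> carrier_mat r n" using A row_equiv_dims[OF M] by auto
      show "row_equiv M (hnf A)" "row_equiv (hnf A) M"
        using row_equiv_euclidean[OF A] M e by auto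
    qed
    thus ?thesis using e by blast
  qed
  also have "\<dots> \<longleftrightarrow> reducible ((hnf A)\<^sup>T * hnf A)"
  proof -
    have "(hnf A)\<^sup>T * hnf A \<in> carrier_mat n n" using H by auto
    moreover have "((hnf A)\<^sup>T * hnf A)\<^sup>T = (hnf A)\<^sup>T * hnf A"
      using transpose_mult[of "(hnf A)\<^sup>T" n r "hnf A" n] H by simp
    ultimately show ?thesis
      by (simp add: reducible_iff_partition rows_split_iff_gram[OF pre H] del: index_mult_mat)
  qed
  finally show ?thesis .
qed

end
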